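(* Let $K$ be a compact Hausdorff space with an isolated point and let $X$ be a real Banach space. If $X^*$ has the $w^*$-ball dentable property, then $C(K,X)^*$ has the $w^*$-ball dentable property.
   Context: $C(K,X)$ denotes the space of continuous $X$-valued functions on $K$, equipped with the supremum norm. $B_Z$ denotes the closed unit ball of a Banach space $Z$, and $Z^*$ its dual. For a bounded set $C \subseteq Z^*$, $z \in Z$ with $\|z\| = 1$ and $\alpha > 0$, the set $\{z^* \in C : z^*(z) > \sup_{c^* \in C} c^*(z) - \alpha\}$ is called a (open) $w^*$-slice of $C$. The dual space $Z^*$ is said to have the $w^*$-ball dentable property ($w^*$-BDP) if $B_{Z^*}$ has $w^*$-slices (determined by elements of $Z$) of arbitrarily small diameter, i.e. for every $\varepsilon > 0$ there is a $w^*$-slice $S$ of $B_{Z^*}$ with $\operatorname{diam}(S) < \varepsilon$. *)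

theory Defs
  imports "HOL-Analysis.Analysis"
begin

text \<open>
  The dual of a real normed space \<open>'z\<close> is the type \<open>'z \<Rightarrow>\<^sub>L real\<close>, whose norm is the operator norm.
  For a compact space \<open>'k\<close>, the type \<open>'k \<Rightarrow>\<^sub>C 'x\<close> of bounded continuous functions consists of all
  continuous functions, and its norm is the supremum norm; the first two lemmas record this.
\<close>

lemma bcontfun_compact_UNIV:
  assumes "compact (UNIV :: 'k::topological_space set)"
  shows "(bcontfun :: ('k \<Rightarrow> 'x::metric_space) set) = {f. continuous_on UNIV f}"
  using assms by (auto simp: bcontfun_def intro: compact_imp_bounded compact_continuous_image)

lemma norm_bcontfun_SUP:
  fixes f :: "'k::topological_space \<Rightarrow>\<^sub>C 'x::real_normed_vector"
  shows "norm f = (SUP t. norm (apply_bcontfun f t))"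
  unfolding norm_bcontfun_def dist_bcontfun.rep_eq zero_bcontfun.rep_eq by simp

text \<open>
  Slices are only meant for bounded \<open>C\<close>: the supremum is then a genuine one (if \<open>C\<close> is nonempty).
\<close>

definition wstar_slice ::
  "('z::real_normed_vector \<Rightarrow>\<^sub>L real) set \<Rightarrow> 'z \<Rightarrow> real \<Rightarrow> ('z \<Rightarrow>\<^sub>L real) set" where
  "wstar_slice C z \<alpha> =
     {f \<in> C. blinfun_apply f z > (SUP g\<in>C. blinfun_apply g z) - \<alpha>}"

definition is_wstar_slice ::
  "('z::real_normed_vector \<Rightarrow>\<^sub>L real) set \<Rightarrow> ('z \<Rightarrow>\<^sub>L real) set \<Rightarrow> bool" where
  "is_wstar_slice S C \<longleftrightarrow>
     bounded C \<and> (\<exists>z \<alpha>. norm z = 1 \<and> \<alpha> > 0 \<and> S = wstar_slice C z \<alpha>)"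

text \<open>
  \<open>wstar_BDP TYPE('z)\<close> says that the dual of \<open>'z\<close> has the property. The predual is the parameter,
  since slices are determined by its elements. The class is \<open>real_normed_vector\<close> because
  \<open>'k \<Rightarrow>\<^sub>C 'x\<close> is a library instance of \<open>banach\<close> only for metric \<open>'k\<close>.
\<close>

definition wstar_BDP :: "'z::real_normed_vector itself \<Rightarrow> bool" where
  "wstar_BDP _ \<longleftrightarrow>
     (\<forall>\<epsilon>>0. \<exists>S. is_wstar_slice S (cball (0 :: 'z \<Rightarrow>\<^sub>L real) 1) \<and> diameter S < \<epsilon>)"

end

theory Submission
  imports Defs
begin

text \<open>
  Let \<open>t\<close> be an isolated point and let \<open>e x\<close> be the function equal to \<open>x\<close> at \<open>t\<close> and to \<open>0\<close>
  elsewhere. Any \<open>h\<close> in \<open>C(K,X)\<close> splits as \<open>h = e (h t) + r\<close> with \<open>r t = 0\<close>, and \<open>e x + r\<close> and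
  \<open>e x - r\<close> both lie in the unit ball when \<open>x\<close> and \<open>r\<close> do. Hence a functional \<open>F\<close> in the dual ball
  satisfies \<open>F (e x) + \<bar>F r\<bar> \<le> 1\<close>: on the slice determined by \<open>e x\<close> with a small \<open>a\<close>, the part
  \<open>F r\<close> is below \<open>a\<close>, while \<open>F \<circ> e\<close> stays in the given small slice of the dual ball of \<open>X\<close>.
  That the slice of \<open>e x\<close> has supremum \<open>1\<close> is the Hahn-Banach theorem, which is obtained here from
  a minimal sublinear functional.
\<close>

section \<open>Norming functionals\<close>

text \<open>Scaling is required only as an inequality for positive factors, which passes easily to
  infima; equality for all \<open>c \<ge> 0\<close> is recovered in
  \<open>sublinear_scaleR\<close>.\<close>

definition sublinear :: "('a::real_vector \<Rightarrow> real) \<Rightarrow> bool" where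
  "sublinear p \<longleftrightarrow> (\<forall>x y. p (x + y) \<le> p x + p y) \<and> (\<forall>c>0. \<forall>x. p (c *\<^sub>R x) \<le> c * p x)"

lemma sublinear_add: "sublinear p \<Longrightarrow> p (x + y) \<le> p x + p y"
  and sublinear_scaleR_le: "sublinear p \<Longrightarrow> c > 0 \<Longrightarrow> p (c *\<^sub>R x) \<le> c * p x"
  by (auto simp: sublinear_def)

lemma sublinear_0:
  assumes "sublinear p"
  shows "p 0 = 0"
  using sublinear_add[OF assms, of 0 0] sublinear_scaleR_le[OF assms, of "1/2" 0] by simp

lemma sublinear_scaleR:
  assumes "sublinear p" "c \<ge> 0"
  shows "p (c *\<^sub>R x) = c * p x"
proof (cases "c = 0")
  case False
  with assms have c: "c > 0" by simp
  have "p ((1/c) *\<^sub>R (c *\<^sub>R x)) \<le> (1/c) * p (c *\<^sub>R x)"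
    using c by (intro sublinear_scaleR_le assms) simp
  with c have "c * p x \<le> p (c *\<^sub>R x)"
    by (simp add: field_simps)
  with sublinear_scaleR_le[OF assms(1) c, of x] show ?thesis by simp
qed (simp add: sublinear_0[OF assms(1)])

lemma sublinear_minus_le:
  assumes "sublinear p"
  shows "- p (- x) \<le> p x"
  using sublinear_add[OF assms, of x "- x"] sublinear_0[OF assms] by simp

lemma sublinear_norm: "sublinear (norm :: 'a::real_normed_vector \<Rightarrow> real)"
  by (simp add: sublinear_def norm_triangle_ineq)

text \<open>Lowering \<open>p\<close> along the ray through \<open>y\<close> keeps it sublinear. If
  \<open>p\<close> is minimal, then \<open>q = p\<close>, which forces \<open>p\<close> to be odd;
  if \<open>p\<close> is the norm, a linear functional below \<open>q\<close> attains the norm at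
  \<open>y\<close>.\<close>

lemma sublinear_lower_at:
  fixes p :: "'a::real_vector \<Rightarrow> real"
  assumes p: "sublinear p"
  obtains q where "sublinear q" "q \<le> p" "q (- y) \<le> - p y"
proof
  \<comment> \<open>The choice \<open>t = 0\<close> gives \<open>q \<le> p\<close>, and
    \<open>t = 1\<close> at \<open>- y\<close> gives \<open>q (- y) \<le> p 0 - p y\<close>.\<close>
  define q where "q x = (INF t\<in>{0..}. p (x + t *\<^sub>R y) - t * p y)" for x
  \<comment> \<open>A bound free of \<open>t\<close> makes the infimum a genuine one.\<close>
  have below: "- p (- x) \<le> p (x + t *\<^sub>R y) - t * p y" if "t \<ge> 0" for x t
    using sublinear_add[OF p, of "x + t *\<^sub>R y" "- x"] sublinear_scaleR[OF p that, of y] by simp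
  have bdd: "bdd_below ((\<lambda>t. p (x + t *\<^sub>R y) - t * p y) ` {0..})" for x
    using below by (intro bdd_belowI2[where m = "- p (- x)"]) auto
  have q_le: "q x \<le> p (x + t *\<^sub>R y) - t * p y" if "t \<ge> 0" for x t
    unfolding q_def using that by (intro cINF_lower bdd) auto
  have q_ge: "m \<le> q x" if "\<And>t. t \<ge> 0 \<Longrightarrow> m \<le> p (x + t *\<^sub>R y) - t * p y" for m x
    unfolding q_def using that by (intro cINF_greatest) auto
  have add: "q (x + z) \<le> q x + q z" for x z
  proof -
    \<comment> \<open>The parameters \<open>s\<close> for \<open>x\<close> and \<open>t\<close> for
      \<open>z\<close> combine to \<open>s + t\<close> for \<open>x + z\<close>; the infimum is then
      taken over \<open>s\<close> first and over \<open>t\<close> afterwards.\<close>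
    have "q (x + z) - (p (z + t *\<^sub>R y) - t * p y) \<le> p (x + s *\<^sub>R y) - s * p y"
      if "s \<ge> 0" "t \<ge> 0" for s t
    proof -
      have "q (x + z) \<le> p ((x + z) + (s + t) *\<^sub>R y) - (s + t) * p y"
        using that by (intro q_le) simp
      also have "(x + z) + (s + t) *\<^sub>R y = (x + s *\<^sub>R y) + (z + t *\<^sub>R y)"
        by (simp add: algebra_simps)
      finally show ?thesis
        using sublinear_add[OF p, of "x + s *\<^sub>R y" "z + t *\<^sub>R y"] by (simp add: algebra_simps)
    qed
    then have "q (x + z) - (p (z + t *\<^sub>R y) - t * p y) \<le> q x" if "t \<ge> 0" for t
      using that by (intro q_ge) auto
    then have "q (x + z) - q x \<le> q z"
      by (intro q_ge) (simp add: algebra_simps)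
    then show ?thesis by simp
  qed
  have scale: "q (c *\<^sub>R x) \<le> c * q x" if c: "c > 0" for c x
  proof -
    have "q (c *\<^sub>R x) / c \<le> p (x + t *\<^sub>R y) - t * p y" if "t \<ge> 0" for t
    proof -
      have "q (c *\<^sub>R x) \<le> p (c *\<^sub>R x + (c * t) *\<^sub>R y) - (c * t) * p y"
        using that c by (intro q_le) simp
      also have "p (c *\<^sub>R x + (c * t) *\<^sub>R y) = c * p (x + t *\<^sub>R y)"
        using sublinear_scaleR[OF p, of c "x + t *\<^sub>R y"] c by (simp add: algebra_simps)
      finally show ?thesis
        using c by (simp add: field_simps)
    qed
    then have "q (c *\<^sub>R x) / c \<le> q x"
      by (rule q_ge)
    with c show ?thesis by (simp add: field_simps)
  qed
  show "sublinear q"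
    using add scale by (simp add: sublinear_def)
  show "q \<le> p"
    using q_le[of 0] by (auto simp: le_fun_def)
  show "q (- y) \<le> - p y"
    using q_le[of 1 "- y"] sublinear_0[OF p] by simp
qed

text \<open>This supplies the lower bounds for Zorn's lemma. The pointwise infimum is finite because
  each \<open>q\<close> in the chain satisfies
  \<open>q x \<ge> - q (- x) \<ge> - p (- x)\<close>.\<close>

lemma sublinear_INF_chain:
  fixes p :: "'a::real_vector \<Rightarrow> real"
  assumes ne: "C \<noteq> {}" and C: "\<And>q. q \<in> C \<Longrightarrow> sublinear q \<and> q \<le> p"
    and chain: "\<And>q r. q \<in> C \<Longrightarrow> r \<in> C \<Longrightarrow> q \<le> r \<or> r \<le> q"
  obtains u where "sublinear u" "\<And>q. q \<in> C \<Longrightarrow> u \<le> q"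
proof
  define u where "u x = (INF q\<in>C. q x)" for x
  have "- p (- x) \<le> q x" if "q \<in> C" for q x
  proof -
    have "q (- x) \<le> p (- x)"
      using C[OF that] by (simp add: le_fun_def)
    with sublinear_minus_le[of q x] C[OF that] show ?thesis by linarith
  qed
  then have bdd: "bdd_below ((\<lambda>q. q x) ` C)" for x
    by (intro bdd_belowI2[where m = "- p (- x)"]) auto
  have u_le: "u x \<le> q x" if "q \<in> C" for q x
    unfolding u_def using that by (intro cINF_lower bdd) auto
  have u_ge: "m \<le> u x" if "\<And>q. q \<in> C \<Longrightarrow> m \<le> q x" for m x
    unfolding u_def using that ne by (intro cINF_greatest) auto
  show "u \<le> q" if "q \<in> C" for q
    using u_le[OF that] by (simp add: le_fun_def)
  have add: "u (x + z) \<le> u x + u z" for x z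
  proof -
    have "u (x + z) - r z \<le> q x" if q: "q \<in> C" and r: "r \<in> C" for q r
    proof -
      \<comment> \<open>Subadditivity needs a single function below both \<open>q\<close> and
        \<open>r\<close>; in a chain the smaller of the two serves.\<close>
      obtain s where s: "s \<in> C" "s \<le> q" "s \<le> r"
        using chain[OF q r] q r by auto
      have "u (x + z) \<le> s x + s z"
        using u_le[OF s(1), of "x + z"] sublinear_add[of s x z] C[OF s(1)] by linarith
      also have "\<dots> \<le> q x + r z"
        using s by (intro add_mono) (auto simp: le_fun_def)
      finally show ?thesis by simp
    qed
    then have "u (x + z) - r z \<le> u x" if "r \<in> C" for r
      using that by (intro u_ge)
    then have "u (x + z) - u x \<le> u z"
      by (intro u_ge) (simp add: algebra_simps)
    then show ?thesis by simp
  qed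
  have scale: "u (c *\<^sub>R x) \<le> c * u x" if c: "c > 0" for c x
  proof -
    have "u (c *\<^sub>R x) / c \<le> q x" if "q \<in> C" for q
      using u_le[OF that, of "c *\<^sub>R x"] sublinear_scaleR_le[of q c x] C[OF that] c
      by (simp add: field_simps)
    then have "u (c *\<^sub>R x) / c \<le> u x"
      by (rule u_ge)
    with c show ?thesis by (simp add: field_simps)
  qed
  show "sublinear u"
    using add scale by (simp add: sublinear_def)
qed

text \<open>Zorn's lemma gives a minimal sublinear function below \<open>p\<close>. Minimality makes
  it odd, and an odd sublinear function is linear.\<close>

theorem sublinear_dominates_linear:
  fixes p :: "'a::real_vector \<Rightarrow> real"
  assumes p: "sublinear p"
  obtains f where "linear f" "f \<le> p"
proof -
  define A where "A = {q. sublinear q \<and> q \<le> p}"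
  have "\<exists>m\<in>A. \<forall>q\<in>A. q \<le> m \<longrightarrow> q = m"
  \<comment> \<open>The order is reversed, so that a maximal element is a minimal function.\<close>
  proof (rule predicate_Zorn)
    show "partial_order_on A (relation_of (\<lambda>q r. r \<le> q) A)"
      by (rule partial_order_on_relation_ofI) auto
  next
    fix C assume C: "C \<in> Chains (relation_of (\<lambda>q r. r \<le> q) A)"
    then have sub: "sublinear q \<and> q \<le> p" if "q \<in> C" for q
      using that by (auto simp: Chains_def relation_of_def A_def)
    from C have chain: "q \<le> r \<or> r \<le> q" if "q \<in> C" "r \<in> C" for q r
      using that by (auto simp: Chains_def relation_of_def)
    show "\<exists>u\<in>A. \<forall>q\<in>C. u \<le> q"
    proof (cases "C = {}")
      case True
      then show ?thesis using p by (auto simp: A_def)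
    next
      case False
      then obtain u where u: "sublinear u" "\<And>q. q \<in> C \<Longrightarrow> u \<le> q"
        using sublinear_INF_chain[of C p] sub chain by metis
      moreover from u False sub have "u \<le> p"
        by (metis equals0I order_trans)
      ultimately show ?thesis by (auto simp: A_def)
    qed
  qed
  then obtain m where "m \<in> A" and min_A: "\<And>q. q \<in> A \<Longrightarrow> q \<le> m \<Longrightarrow> q = m"
    by blast
  then have m: "sublinear m" "m \<le> p"
    by (simp_all add: A_def)
  have min: "q = m" if "sublinear q" "q \<le> m" for q
    using that m(2) by (intro min_A) (auto simp: A_def intro: order_trans)
  have neg: "m (- y) = - m y" for y
  proof -
    obtain q where "sublinear q" "q \<le> m" "q (- y) \<le> - m y"
      using sublinear_lower_at[OF m(1)] .
    with min have "m (- y) \<le> - m y" by blast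
    with sublinear_minus_le[OF m(1), of "- y"] show ?thesis by simp
  qed
  have "linear m"
  proof (rule linearI)
    \<comment> \<open>Subadditivity at \<open>- x\<close> and \<open>- y\<close> turns, by oddness,
      into the reverse inequality.\<close>
    show "m (x + y) = m x + m y" for x y
      using sublinear_add[OF m(1), of x y] sublinear_add[OF m(1), of "- x" "- y"] neg[of "x + y"]
      by (simp add: neg)
    show "m (c *\<^sub>R x) = c *\<^sub>R m x" for c x
      using sublinear_scaleR[OF m(1), of c x] sublinear_scaleR[OF m(1), of "- c" x]
      by (cases "c \<ge> 0") (auto simp: neg)
  qed
  with m(2) that show thesis by blast
qed

text \<open>A linear \<open>f\<close> below the norm lowered at \<open>x\<close> has
  \<open>f (- x) \<le> - norm x\<close>, hence \<open>f x \<ge> norm x\<close>, while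
  \<open>f \<le> norm\<close> bounds its operator norm by 1.\<close>

lemma norming_functional:
  fixes x :: "'a::real_normed_vector"
  obtains f :: "'a \<Rightarrow>\<^sub>L real" where "norm f \<le> 1" "f x = norm x"
proof -
  obtain q where q: "sublinear q" "q \<le> norm" "q (- x) \<le> - norm x"
    using sublinear_lower_at[OF sublinear_norm] .
  then obtain f where f: "linear f" "f \<le> q"
    using sublinear_dominates_linear by blast
  have le: "f y \<le> norm y" for y
    using f(2) q(2) by (meson le_fun_def order_trans)
  have bound: "norm (f y) \<le> norm y * 1" for y
    using le[of y] le[of "- y"] f(1) by (simp add: linear_neg abs_le_iff)
  then have "bounded_linear f"
    using f(1) by (intro bounded_linear_intro[of f 1]) (auto simp: linear_add linear_scale)
  then have app: "blinfun_apply (Blinfun f) = f"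
    by (rule bounded_linear_Blinfun_apply)
  have "f (- x) \<le> - norm x"
    using f(2) q(3) by (meson le_fun_def order_trans)
  then have "f x = norm x"
    using le[of x] f(1) by (simp add: linear_neg)
  moreover have "norm (Blinfun f) \<le> 1"
    using bound by (intro norm_blinfun_bound) (auto simp: app mult.commute)
  ultimately show thesis
    using that[of "Blinfun f"] by (simp add: app)
qed

section \<open>Slices of the dual ball\<close>

lemma dual_ball_apply_le:
  fixes f :: "'a::real_normed_vector \<Rightarrow>\<^sub>L real"
  assumes "f \<in> cball 0 1"
  shows "\<bar>f z\<bar> \<le> norm z"
  using norm_blinfun[of f z] mult_right_mono[of "norm f" 1 "norm z"] assms by simp

lemma SUP_dual_ball:
  fixes z :: "'a::real_normed_vector"
  shows "(SUP f\<in>cball (0 :: 'a \<Rightarrow>\<^sub>L real) 1. blinfun_apply f z) = norm z"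
proof (rule cSup_eq_maximum)
  obtain f :: "'a \<Rightarrow>\<^sub>L real" where "norm f \<le> 1" "f z = norm z"
    by (rule norming_functional)
  then show "norm z \<in> (\<lambda>f. blinfun_apply f z) ` cball 0 1"
    by (intro image_eqI[of _ _ f]) auto
  show "y \<le> norm z" if "y \<in> (\<lambda>f. blinfun_apply f z) ` cball 0 1" for y
    using that dual_ball_apply_le[of _ z] by (auto intro: abs_le_D1)
qed

lemma wstar_slice_dual_ball:
  fixes z :: "'a::real_normed_vector"
  shows "wstar_slice (cball 0 1) z \<alpha> = {f \<in> cball 0 1. blinfun_apply f z > norm z - \<alpha>}"
  by (simp only: wstar_slice_def SUP_dual_ball)

text \<open>Exchanging \<open>f\<close> and \<open>g\<close> turns the one-sided bound into an
  absolute one, and homogeneity extends it from the unit ball to an operator norm bound.\<close>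

lemma diameter_le_dual_ball:
  fixes S :: "('a::real_normed_vector \<Rightarrow>\<^sub>L real) set"
  assumes "0 \<le> d" and le: "\<And>f g h. f \<in> S \<Longrightarrow> g \<in> S \<Longrightarrow> norm h \<le> 1 \<Longrightarrow> f h - g h \<le> d"
  shows "diameter S \<le> d"
proof (rule diameter_le)
  fix f g assume fg: "f \<in> S" "g \<in> S"
  show "norm (f - g) \<le> d"
  proof (rule norm_blinfun_bound)
    fix h :: 'a
    show "norm ((f - g) h) \<le> d * norm h"
    proof (cases "h = 0")
      case False
      define u where "u = h /\<^sub>R norm h"
      have "norm u \<le> 1" and h: "h = norm h *\<^sub>R u"
        using False by (simp_all add: u_def)
      then have "\<bar>f u - g u\<bar> \<le> d"
        using le[OF fg, of u] le[OF fg(2) fg(1), of u] by linarith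
      moreover have "(f - g) h = norm h * (f u - g u)"
        by (subst h) (simp add: blinfun.bilinear_simps algebra_simps)
      ultimately show ?thesis
        by (simp add: abs_mult mult.commute[of d] mult_left_mono)
    qed (simp add: blinfun.bilinear_simps)
  qed (fact assms(1))
qed (use assms(1) in simp)

section \<open>Functions supported at an isolated point\<close>

text \<open>For a general \<open>t\<close> the function need not be continuous and
  \<open>Bcontfun\<close> may return an unspecified value; the lemmas below therefore take
  \<open>t\<close> isolated.\<close>

definition point_bcontfun ::
    "'k::t2_space \<Rightarrow> 'x::real_normed_vector \<Rightarrow> 'k \<Rightarrow>\<^sub>C 'x" where
  "point_bcontfun t x = Bcontfun (\<lambda>s. if s = t then x else 0)"

lemma apply_point_bcontfun:
  assumes "t isolated_in UNIV"
  shows "apply_bcontfun (point_bcontfun t x) s = (if s = t then x else 0)"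
proof -
  have "open {t}"
    using assms by (auto simp: isolated_in_def)
  \<comment> \<open>Both \<open>{t}\<close> and its complement are closed, so the two constant
    pieces glue.\<close>
  then have "continuous_on ({t} \<union> - {t}) (\<lambda>s. if s = t then x else 0)"
    by (intro continuous_on_If) (auto simp: closed_Compl)
  then have "continuous_on UNIV (\<lambda>s. if s = t then x else 0)"
    by simp
  moreover have "bounded (range (\<lambda>s. if s = t then x else 0))"
    by (rule finite_imp_bounded, rule finite_subset[of _ "{x, 0}"]) auto
  ultimately have "(\<lambda>s. if s = t then x else 0) \<in> bcontfun"
    by (simp add: bcontfun_def)
  then show ?thesis
    by (simp add: point_bcontfun_def Bcontfun_inverse)
qed

lemma norm_point_bcontfun:
  assumes "t isolated_in UNIV"
  shows "norm (point_bcontfun t x) = norm x"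
proof (rule antisym)
  show "norm (point_bcontfun t x) \<le> norm x"
    by (rule norm_bound) (simp add: apply_point_bcontfun[OF assms])
  show "norm x \<le> norm (point_bcontfun t x)"
    using norm_bounded[of "point_bcontfun t x" t] by (simp add: apply_point_bcontfun[OF assms])
qed

lemma bounded_linear_point_bcontfun:
  assumes "t isolated_in UNIV"
  shows "bounded_linear (point_bcontfun t :: 'x::real_normed_vector \<Rightarrow> _)"
proof (rule bounded_linear_intro[where K = 1])
  show "point_bcontfun t (x + y) = point_bcontfun t x + point_bcontfun t y" for x y :: 'x
    by (rule bcontfun_eqI) (simp add: apply_point_bcontfun[OF assms])
  show "point_bcontfun t (c *\<^sub>R x) = c *\<^sub>R point_bcontfun t x" for c and x :: 'x
    by (rule bcontfun_eqI) (simp add: apply_point_bcontfun[OF assms])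
qed (simp add: norm_point_bcontfun[OF assms])

lemma dual_ball_compl_point_le:
  fixes F :: "('k::t2_space \<Rightarrow>\<^sub>C 'x::real_normed_vector) \<Rightarrow>\<^sub>L real"
  assumes t: "t isolated_in UNIV" and F: "F \<in> cball 0 1" and x: "norm x \<le> 1"
    and r: "norm r \<le> 1" "apply_bcontfun r t = 0"
  shows "F (point_bcontfun t x) + \<bar>F r\<bar> \<le> 1"
proof -
  have r_le: "norm (apply_bcontfun r s) \<le> 1" for s
    using norm_bounded[of r s] r(1) by linarith
  \<comment> \<open>The summands have disjoint supports, so the norm of the sum or difference is at
    most the larger of the two norms.\<close>
  have "norm (point_bcontfun t x + r) \<le> 1" "norm (point_bcontfun t x - r) \<le> 1"
    using r_le x r(2) by (auto intro!: norm_bound simp: apply_point_bcontfun[OF t])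
  then have "\<bar>F (point_bcontfun t x + r)\<bar> \<le> 1" "\<bar>F (point_bcontfun t x - r)\<bar> \<le> 1"
    using dual_ball_apply_le[OF F] order_trans by blast+
  then show ?thesis
    by (simp add: blinfun.bilinear_simps)
qed

theorem corollary8:
  assumes "compact (UNIV :: 'k::t2_space set)"
    and "\<exists>t::'k. t isolated_in UNIV"
    and "wstar_BDP TYPE('x::banach)"
  shows "wstar_BDP TYPE('k \<Rightarrow>\<^sub>C 'x)"
  unfolding wstar_BDP_def
proof (intro allI impI)
  fix \<epsilon> :: real assume \<epsilon>: "\<epsilon> > 0"
  obtain t :: 'k where t: "t isolated_in UNIV"
    using assms(2) by blast
  let ?e = "point_bcontfun t :: 'x \<Rightarrow> 'k \<Rightarrow>\<^sub>C 'x"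
  have "\<epsilon>/2 > 0" using \<epsilon> by simp
  then obtain S where S: "is_wstar_slice S (cball (0 :: 'x \<Rightarrow>\<^sub>L real) 1)" "diameter S < \<epsilon>/2"
    using assms(3) unfolding wstar_BDP_def by blast
  then obtain x \<alpha> where x: "norm x = 1" and \<alpha>: "\<alpha> > 0" and S_eq: "S = wstar_slice (cball 0 1) x \<alpha>"
    unfolding is_wstar_slice_def by blast
  have S_bdd: "bounded S"
    by (rule bounded_subset[OF bounded_cball[of 0 1]]) (auto simp: S_eq wstar_slice_def)
  \<comment> \<open>The bound by \<alpha> puts the restrictions of functionals in \<open>T\<close>
    into \<open>S\<close>; the bound by \<open>\<epsilon>/8\<close> keeps
    \<open>diameter S + 2 * a\<close> below \<epsilon>.\<close>
  define a where "a = min \<alpha> (\<epsilon>/8)"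
  define T where "T = wstar_slice (cball 0 1) (?e x) a"
  have a: "a > 0" "a \<le> \<alpha>" "a \<le> \<epsilon>/8"
    using \<alpha> \<epsilon> by (auto simp: a_def)
  have T_iff: "F \<in> T \<longleftrightarrow> F \<in> cball 0 1 \<and> F (?e x) > 1 - a" for F
    by (simp add: T_def wstar_slice_dual_ball norm_point_bcontfun[OF t] x)
  define E where "E = Blinfun ?e"
  have E: "blinfun_apply E = ?e"
    unfolding E_def by (intro bounded_linear_Blinfun_apply bounded_linear_point_bcontfun t)
  \<comment> \<open>Composition with the isometry \<open>E\<close> does not increase the norm, and
    the value at \<open>x\<close> exceeds \<open>1 - a \<ge> 1 - \<alpha>\<close>.\<close>
  have restr: "F o\<^sub>L E \<in> S" if "F \<in> T" for F
  proof -
    have "F \<in> cball 0 1" and Fx: "F (?e x) > 1 - a"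
      using that T_iff by auto
    then have "norm ((F o\<^sub>L E) y) \<le> 1 * norm y" for y
      using dual_ball_apply_le[of F "?e y"] by (simp add: E norm_point_bcontfun[OF t])
    then have "norm (F o\<^sub>L E) \<le> 1"
      by (intro norm_blinfun_bound) auto
    with Fx a(2) show ?thesis
      by (simp add: S_eq wstar_slice_dual_ball x E)
  qed
  have "diameter T \<le> diameter S + 2 * a"
  proof (rule diameter_le_dual_ball)
    show "0 \<le> diameter S + 2 * a"
      using diameter_ge_0[OF S_bdd] a(1) by simp
  next
    fix F G :: "('k \<Rightarrow>\<^sub>C 'x) \<Rightarrow>\<^sub>L real" and h :: "'k \<Rightarrow>\<^sub>C 'x"
    assume F: "F \<in> T" and G: "G \<in> T" and h: "norm h \<le> 1"
    have h_le: "norm (apply_bcontfun h s) \<le> 1" for s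
      using norm_bounded[of h s] h by linarith
    define r where "r = h - ?e (apply_bcontfun h t)"
    have rt: "apply_bcontfun r t = 0"
      by (simp add: r_def apply_point_bcontfun[OF t])
    \<comment> \<open>\<open>r\<close> agrees with \<open>h\<close> away from \<open>t\<close> and
      vanishes at \<open>t\<close>.\<close>
    have r: "norm r \<le> 1"
      using h_le by (auto intro!: norm_bound simp: r_def apply_point_bcontfun[OF t])
    have small: "\<bar>H r\<bar> < a" if "H \<in> T" for H
      using that dual_ball_compl_point_le[OF t _ _ r rt, of H x] T_iff[of H] x by auto
    have "norm ((F o\<^sub>L E) - (G o\<^sub>L E)) \<le> diameter S"
      using diameter_bounded_bound[OF S_bdd restr[OF F] restr[OF G]] by (simp add: dist_norm)
    \<comment> \<open>On the part of \<open>h\<close> at \<open>t\<close>, the functionals differ by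
      at most the diameter of \<open>S\<close>, since \<open>apply_bcontfun h t\<close> lies in the
      unit ball of \<open>'x\<close>.\<close>
    then have "\<bar>((F o\<^sub>L E) - (G o\<^sub>L E)) (apply_bcontfun h t)\<bar> \<le> diameter S * 1"
      using norm_blinfun[of "(F o\<^sub>L E) - (G o\<^sub>L E)" "apply_bcontfun h t"] h_le[of t]
        mult_mono[of "norm ((F o\<^sub>L E) - (G o\<^sub>L E))" "diameter S" "norm (apply_bcontfun h t)" 1]
        diameter_ge_0[OF S_bdd] by simp
    then have "F (?e (apply_bcontfun h t)) - G (?e (apply_bcontfun h t)) \<le> diameter S"
      by (simp add: blinfun.bilinear_simps E)
    moreover have "F h = F (?e (apply_bcontfun h t)) + F r" "G h = G (?e (apply_bcontfun h t)) + G r"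
      by (simp_all add: r_def blinfun.bilinear_simps)
    ultimately show "F h - G h \<le> diameter S + 2 * a"
      using small[OF F] small[OF G] by linarith
  qed
  also have "\<dots> < \<epsilon>"
    using S(2) a(3) \<epsilon> by linarith
  finally have "diameter T < \<epsilon>" .
  moreover have "is_wstar_slice T (cball 0 1)"
    unfolding is_wstar_slice_def T_def
    using a(1) x norm_point_bcontfun[OF t, of x] by (intro conjI bounded_cball exI) auto
  ultimately show "\<exists>S. is_wstar_slice S (cball (0 :: ('k \<Rightarrow>\<^sub>C 'x) \<Rightarrow>\<^sub>L real) 1) \<and> diameter S < \<epsilon>"
    by blast
qed

end
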